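(* For any integer $d\ge 1$ there exists $N_0(d)$ such that for all integers $N\ge N_0(d)$, \[ \mathrm{HG}(G_d(N)) = s_d - 1, \] where $s_d$ is the $d$-th term of Sylvester's sequence.
   Context: Hat guessing game: players sit on the vertices of a finite simple graph $G$; an adversary places on each vertex a hat of one of $q$ colors. Each player sees only the hat colors of its neighbors (not its own) and, following a strategy agreed in advance (a deterministic function of the colors it sees), guesses its own hat color; all guess simultaneously. The players win if at least one player guesses correctly. The hat guessing number $\mathrm{HG}(G)$ is the largest $q$ for which the players have a strategy that wins for every hat assignment with $q$ colors. $T_d(N)$ is the complete rooted $N$-ary tree of depth $d$ (root at depth $0$, every vertex at depth less than $d$ has exactly $N$ children, leaves at depth $d$). $G_d(N)$ is the graph obtained from $T_d(N)$ by adding an edge between every vertex and each of its ancestors (if not already present). Sylvester's sequence: $s_0=2$ and $s_n = s_0 s_1\cdots s_{n-1}+1 = s_{n-1}^2-s_{n-1}+1$ for $n\ge 1$. *)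

theory Defs
  imports Main "HOL-Library.FuncSet"
begin

definition simple_graph :: "'a set \<Rightarrow> 'a set set \<Rightarrow> bool" where
  "simple_graph V E \<longleftrightarrow>
     finite V \<and> (\<forall>e\<in>E. \<exists>u\<in>V. \<exists>v\<in>V. u \<noteq> v \<and> e = {u, v})"

definition nbrs :: "'a set \<Rightarrow> 'a set set \<Rightarrow> 'a \<Rightarrow> 'a set" where
  "nbrs V E v = {u \<in> V. {u, v} \<in> E}"

text \<open>The colors are \<open>0, \<dots>, q - 1\<close>. A strategy assigns to every player a map from the
  colorings of its neighborhood to colors.\<close>

definition strategies ::
  "'a set \<Rightarrow> 'a set set \<Rightarrow> nat \<Rightarrow> ('a \<Rightarrow> ('a \<Rightarrow> nat) \<Rightarrow> nat) set" where
  "strategies V E q = (\<Pi> v\<in>V. (nbrs V E v \<rightarrow>\<^sub>E {..<q}) \<rightarrow> {..<q})"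

definition winning ::
  "'a set \<Rightarrow> 'a set set \<Rightarrow> nat \<Rightarrow> ('a \<Rightarrow> ('a \<Rightarrow> nat) \<Rightarrow> nat) \<Rightarrow> bool" where
  "winning V E q g \<longleftrightarrow>
     (\<forall>c \<in> V \<rightarrow>\<^sub>E {..<q}. \<exists>v\<in>V. g v (restrict c (nbrs V E v)) = c v)"

text \<open>For a finite nonempty graph the greatest \<open>q\<close> exists: one color is always winnable, and
  averaging over all colorings shows that a winnable \<open>q\<close> is at most the number of vertices.\<close>

definition HG :: "'a set \<Rightarrow> 'a set set \<Rightarrow> nat" where
  "HG V E = (GREATEST q. \<exists>g \<in> strategies V E q. winning V E q g)"

text \<open>A vertex of the complete rooted \<open>N\<close>-ary tree of depth \<open>d\<close> is encoded by the list of
  child indices on the path from the root, so that its depth is the length of the list.\<close>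

definition tree_verts :: "nat \<Rightarrow> nat \<Rightarrow> nat list set" where
  "tree_verts d N = {u. length u \<le> d \<and> set u \<subseteq> {..<N}}"

definition parent_rel :: "nat \<Rightarrow> nat \<Rightarrow> (nat list \<times> nat list) set" where
  "parent_rel d N =
     {(u, v). u \<in> tree_verts d N \<and> v \<in> tree_verts d N \<and> (\<exists>i. v = u @ [i])}"

definition tree_edges :: "nat \<Rightarrow> nat \<Rightarrow> nat list set set" where
  "tree_edges d N = {{u, v} | u v. (u, v) \<in> parent_rel d N}"

definition G_edges :: "nat \<Rightarrow> nat \<Rightarrow> nat list set set" where
  "G_edges d N = tree_edges d N \<union> {{u, v} | u v. (u, v) \<in> (parent_rel d N)\<^sup>+}"

lemma parent_rel_trancl:
  assumes "(u, v) \<in> (parent_rel d N)\<^sup>+"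
  shows "u \<in> tree_verts d N \<and> v \<in> tree_verts d N \<and> length u < length v"
  using assms by (induction rule: trancl_induct) (auto simp: parent_rel_def)

lemma simple_graph_G: "simple_graph (tree_verts d N) (G_edges d N)"
proof -
  have "finite (tree_verts d N)"
    unfolding tree_verts_def using finite_lists_length_le[of "{..<N}" d]
    by (simp add: conj_commute)
  moreover have "\<exists>u\<in>tree_verts d N. \<exists>v\<in>tree_verts d N. u \<noteq> v \<and> e = {u, v}"
    if e: "e \<in> G_edges d N" for e
  proof -
    obtain u v where uv: "(u, v) \<in> (parent_rel d N)\<^sup>+" "e = {u, v}"
      using e unfolding G_edges_def tree_edges_def by blast
    have "u \<noteq> v" using parent_rel_trancl[OF uv(1)] by auto
    then show ?thesis using parent_rel_trancl[OF uv(1)] uv(2) by blast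
  qed
  ultimately show ?thesis by (simp add: simple_graph_def)
qed

primrec sylvester :: "nat \<Rightarrow> nat" where
  "sylvester 0 = 2"
| "sylvester (Suc n) = (sylvester n)\<^sup>2 - sylvester n + 1"

lemma sylvester_eq_prod: "sylvester n = (\<Prod>i<n. sylvester i) + 1"
proof (induction n)
  case 0
  show ?case by simp
next
  case (Suc n)
  define P where "P = (\<Prod>i<n. sylvester i)"
  have s: "sylvester n = P + 1" using Suc P_def by simp
  have "sylvester (Suc n) = (P + 1)\<^sup>2 - (P + 1) + 1" by (simp add: s)
  also have "\<dots> = P * (P + 1) + 1" by (simp add: power2_eq_square)
  also have "\<dots> = (\<Prod>i<Suc n. sylvester i) + 1" by (simp add: s P_def)
  finally show ?case .
qed

end

theory Submission
  imports Defs "HOL-Library.Sublist"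
begin

text \<open>
  Upper bound: let a vertex at depth \<open>k\<close> use only the colors below \<open>s\<^sub>k\<close>. Going from the leaves to
  the root, fix the color of each vertex once its descendants are fixed. Its guess then depends only
  on its ancestors, so it takes at most \<open>s\<^sub>0 \<cdots> s\<^sub>k\<^sub>-\<^sub>1 = s\<^sub>k - 1\<close> values, and one of the \<open>s\<^sub>k\<close> colors is
  never guessed.

  Lower bound, with \<open>q = s\<^sub>d - 1\<close> colors: for a vertex \<open>u\<close> at depth \<open>k\<close>, the colors of \<open>u\<close> and its
  descendants determine the set \<open>F\<close> of colorings of the ancestors of \<open>u\<close> for which \<open>u\<close> and all its
  descendants guess wrong. The children of a vertex are indexed by all sets \<open>T\<close> of ancestor colorings,
  and the child with index \<open>T\<close> ensures that \<open>T\<close> is not contained in its set \<open>F\<close> whenever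
  \<open>|T| = s\<^sub>k - 1\<close>. It sees its descendants, hence knows the set \<open>B\<close> of colorings of its ancestors and
  itself for which they all fail. The only colors \<open>y\<close> it has to fear satisfy \<open>T \<times> {y} \<subseteq> B\<close>. There
  are at most \<open>s\<^sub>k - 1\<close> of them, since otherwise \<open>B\<close> would contain a set of
  \<open>(s\<^sub>k - 1) s\<^sub>k = s\<^sub>k\<^sub>+\<^sub>1 - 1\<close> colorings, which the children exclude. So its guesses on \<open>T\<close> can cover
  all of these colors. At the root, \<open>s\<^sub>0 - 1 = 1\<close> and so \<open>F\<close> is empty.
\<close>

section \<open>Sylvester's sequence, and adjacency as prefix comparability\<close>

lemma sylvester_gt_1: "1 < sylvester n"
proof (induction n)
  case (Suc n)
  have "sylvester n * 2 \<le> sylvester n * sylvester n" using Suc by (intro mult_le_mono2) simp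
  then show ?case using Suc by (simp add: power2_eq_square)
qed simp

text \<open>The form used for counting: s_k - 1 ancestor colorings, each extended by s_k
  colors.\<close>

lemma sylvester_Suc_minus_1:
  "sylvester (Suc n) - 1 = (sylvester n - 1) * sylvester n"
  by (simp add: power2_eq_square algebra_simps)

lemma sylvester_mono: "m \<le> n \<Longrightarrow> sylvester m \<le> sylvester n"
proof (rule lift_Suc_mono_le[where f = sylvester])
  fix n
  have "1 * sylvester n \<le> (sylvester n - 1) * sylvester n"
    using sylvester_gt_1[of n] by (intro mult_le_mono1) simp
  then show "sylvester n \<le> sylvester (Suc n)"
    using sylvester_Suc_minus_1[of n] by linarith
qed

lemma tree_verts_prefix:
  assumes "prefix u v" "v \<in> tree_verts d N"
  shows "u \<in> tree_verts d N"
  using assms prefix_length_le[OF assms(1)] set_mono_prefix[OF assms(1)]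
  by (auto simp: tree_verts_def)

lemma parent_rel_trancl_iff:
  "(u, v) \<in> (parent_rel d N)\<^sup>+ \<longleftrightarrow> v \<in> tree_verts d N \<and> strict_prefix u v"
proof
  assume "(u, v) \<in> (parent_rel d N)\<^sup>+"
  then show "v \<in> tree_verts d N \<and> strict_prefix u v"
    by (induction rule: trancl_induct)
      (auto simp: parent_rel_def strict_prefix_def)
next
  have "(u, u @ w) \<in> (parent_rel d N)\<^sup>+" if "u @ w \<in> tree_verts d N" "w \<noteq> []" for w
    using that
  proof (induction w rule: rev_induct)
    case (snoc i w)
    have w: "u @ w \<in> tree_verts d N"
      by (rule tree_verts_prefix[OF _ snoc.prems(1)]) simp
    then have step: "(u @ w, u @ w @ [i]) \<in> parent_rel d N"
      using snoc.prems(1) by (auto simp: parent_rel_def)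
    show ?case
      using snoc.IH[OF w] step by (cases "w = []") (auto intro: trancl_into_trancl)
  qed simp
  then show "(u, v) \<in> (parent_rel d N)\<^sup>+" if "v \<in> tree_verts d N \<and> strict_prefix u v"
    using that by (auto simp: strict_prefix_def prefix_def)
qed

text \<open>Tree edges also join an ancestor to a descendant, so only the prefix order
  matters.\<close>

lemma nbrs_G:
  assumes "v \<in> tree_verts d N"
  shows "nbrs (tree_verts d N) (G_edges d N) v =
    {u \<in> tree_verts d N. strict_prefix u v \<or> strict_prefix v u}"
proof -
  have "G_edges d N = {{u, v} | u v. (u, v) \<in> (parent_rel d N)\<^sup>+}"
    unfolding G_edges_def tree_edges_def by blast
  then show ?thesis
    using assms by (auto simp: nbrs_def parent_rel_trancl_iff doubleton_eq_iff)
qed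

section \<open>Upper bound\<close>

lemma strategy_loses:
  assumes q: "sylvester d \<le> q"
    and g: "g \<in> strategies (tree_verts d N) (G_edges d N) q"
  shows "\<not> winning (tree_verts d N) (G_edges d N) q g"
proof -
  let ?V = "tree_verts d N"
  let ?nb = "nbrs ?V (G_edges d N)"
  define small :: "(nat list \<Rightarrow> nat) \<Rightarrow> bool"
    where "small c \<longleftrightarrow> (\<forall>w. c w < sylvester (length w))" for c
  \<comment> \<open>Being wrong must survive every \<open>small\<close> recoloring of the ancestors;
    all other neighbors are longer words and keep their colors.\<close>
  define safe where "safe c v \<longleftrightarrow> (\<forall>c'. small c' \<and> (\<forall>w. length v \<le> length w \<longrightarrow> c' w = c w) \<longrightarrow>
    g v (restrict c' (?nb v)) \<noteq> c v)" for c v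
  \<comment> \<open>\<open>n\<close> counts the levels already colored, from the leaves up; for
    \<open>n = 0\<close> no vertex is long enough.\<close>
  have step: "\<exists>c. small c \<and> (\<forall>v\<in>?V. d + 1 - n \<le> length v \<longrightarrow> safe c v)" for n
  proof (induction n)
    case 0
    have "small (\<lambda>_. 0)" using sylvester_gt_1 by (auto simp: small_def intro: less_trans)
    then show ?case by (auto simp: tree_verts_def)
  next
    case (Suc n)
    then obtain c where c: "small c" "\<And>v. v \<in> ?V \<Longrightarrow> d + 1 - n \<le> length v \<Longrightarrow> safe c v" by blast
    define m where "m = d + 1 - Suc n"
    \<comment> \<open>For \<open>v\<close> at level \<open>m\<close>, only the ancestor colors
      \<open>xs\<close> still vary.\<close>
    define guesses where "guesses v = (\<lambda>xs. g v (restrict (\<lambda>w. if length w < m then xs (length w) else c w) (?nb v)))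
      ` (\<Pi>\<^sub>E i\<in>{..<m}. {..<sylvester i})" for v
    have "\<exists>y<sylvester m. y \<notin> guesses v" for v
    proof -
      have fin: "finite (\<Pi>\<^sub>E i\<in>{..<m}. {..<sylvester i})" by (intro finite_PiE) auto
      have "card (guesses v) \<le> card (\<Pi>\<^sub>E i\<in>{..<m}. {..<sylvester i})"
        unfolding guesses_def by (rule card_image_le[OF fin])
      also have "\<dots> = (\<Prod>i<m. sylvester i)" by (simp add: card_PiE)
      also have "\<dots> < card {..<sylvester m}" using sylvester_eq_prod[of m] by simp
      finally have "\<not> {..<sylvester m} \<subseteq> guesses v"
        using card_mono[of "guesses v" "{..<sylvester m}"] fin by (auto simp: guesses_def)
      then show ?thesis by auto
    qed
    then obtain y where y: "\<And>v. y v < sylvester m" "\<And>v. y v \<notin> guesses v" by metis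
    define c1 where "c1 w = (if length w = m then y w else c w)" for w
    have "small c1" using c(1) y(1) by (auto simp: small_def c1_def)
    moreover have "safe c1 v" if v: "v \<in> ?V" "m \<le> length v" for v
    proof (cases "length v = m")
      case False
      then have "safe c v" using v by (intro c(2)) (auto simp: m_def)
      then show ?thesis using False v(2) by (auto simp: safe_def c1_def)
    next
      case True
      show ?thesis unfolding safe_def
      proof (intro allI impI)
        fix c' assume c': "small c' \<and> (\<forall>w. length v \<le> length w \<longrightarrow> c' w = c1 w)"
        define xs where "xs = (\<lambda>i\<in>{..<m}. c' (take i v))"
        have xs: "xs \<in> (\<Pi>\<^sub>E i\<in>{..<m}. {..<sylvester i})"
        proof -
          have "c' (take i v) < sylvester i" if "i < m" for i
            using c' that True unfolding small_def by (metis length_take min.absorb2 less_imp_le min.commute)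
          then show ?thesis by (auto simp: xs_def)
        qed
        have "restrict c' (?nb v) = restrict (\<lambda>w. if length w < m then xs (length w) else c w) (?nb v)"
        proof (rule restrict_ext)
          fix w assume "w \<in> ?nb v"
          then consider "strict_prefix w v" | "strict_prefix v w" using nbrs_G[OF v(1)] by auto
          then show "c' w = (if length w < m then xs (length w) else c w)"
          proof cases
            case 1
            then have "length w < m" "take (length w) v = w"
              using True prefix_length_less by (auto simp: strict_prefix_def prefix_def)
            then show ?thesis by (simp add: xs_def)
          next
            case 2
            then have "m < length w" using True prefix_length_less by blast
            then show ?thesis using c' True by (simp add: c1_def)
          qed
        qed
        then have "g v (restrict c' (?nb v)) \<in> guesses v" using xs by (auto simp: guesses_def)
        then show "g v (restrict c' (?nb v)) \<noteq> c1 v" using y(2)[of v] True by (auto simp: c1_def)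
      qed
    qed
    ultimately show ?case unfolding m_def by blast
  qed
  obtain c where c: "small c" "\<And>v. v \<in> ?V \<Longrightarrow> safe c v" using step[of "d + 1"] by auto
  have "restrict c ?V \<in> ?V \<rightarrow>\<^sub>E {..<q}"
  proof -
    have "c v < q" if "v \<in> ?V" for v
    proof -
      have "c v < sylvester (length v)" using c(1) by (simp add: small_def)
      also have "\<dots> \<le> sylvester d" using that by (intro sylvester_mono) (simp add: tree_verts_def)
      finally show ?thesis using q by simp
    qed
    then show ?thesis by auto
  qed
  moreover have "g v (restrict (restrict c ?V) (?nb v)) \<noteq> restrict c ?V v" if v: "v \<in> ?V" for v
  proof -
    have "?V \<inter> ?nb v = ?nb v" by (auto simp: nbrs_def)
    then show ?thesis using c v by (simp add: restrict_restrict safe_def)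
  qed
  ultimately show ?thesis unfolding winning_def by blast
qed

section \<open>Lower bound\<close>

text \<open>Inverts an injection of \<open>Y\<close> into \<open>T\<close>, with default value
  \<open>0\<close>.\<close>

lemma ex_cover_map:
  fixes Y :: "nat set"
  assumes "Y \<subseteq> {..<q}" "0 < q" "finite T"
  shows "\<exists>f. (\<forall>x. f x < q) \<and> (card Y \<le> card T \<longrightarrow> Y \<subseteq> f ` T)"
proof (cases "card Y \<le> card T")
  case True
  have "finite Y" using assms(1) finite_subset by blast
  then obtain h where h: "h ` Y \<subseteq> T" "inj_on h Y"
    using card_le_inj[OF _ assms(3) True] by blast
  define f where "f x = (if x \<in> h ` Y then inv_into Y h x else 0)" for x
  have "f x < q" for x using assms inv_into_into[of x h Y] by (auto simp: f_def)
  moreover have "y \<in> f ` T" if "y \<in> Y" for y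
    using that h by (intro image_eqI[of _ _ "h y"]) (auto simp: f_def)
  ultimately show ?thesis by blast
qed (use assms in auto)

text \<open>\<open>child_set i\<close> is the index of the \<open>i\<close>-th child, the same at
  every depth; \<open>cover T Y\<close> is a guess, as a function of the ancestor colors, that hits
  all of \<open>Y\<close> on \<open>T\<close> if \<open>T\<close> is large enough.\<close>

locale hat_strategy =
  fixes d N q :: nat and child_set :: "nat \<Rightarrow> nat list set"
    and cover :: "nat list set \<Rightarrow> nat set \<Rightarrow> nat list \<Rightarrow> nat"
  assumes q: "q = sylvester d - 1"
    and child_set: "\<And>k T. k \<le> d \<Longrightarrow> T \<subseteq> {xs. length xs = k \<and> set xs \<subseteq> {..<q}} \<Longrightarrow>
      \<exists>i<N. child_set i = T"
    and cover_less: "\<And>T Y xs. finite T \<Longrightarrow> Y \<subseteq> {..<q} \<Longrightarrow> cover T Y xs < q"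
    and cover: "\<And>T Y. finite T \<Longrightarrow> Y \<subseteq> {..<q} \<Longrightarrow> card Y \<le> card T \<Longrightarrow> Y \<subseteq> cover T Y ` T"
    and finite_child_set: "\<And>i. finite (child_set i)"
begin

text \<open>The root has only the empty ancestor coloring, and s_0 - 1 = 1.\<close>

definition target :: "nat list \<Rightarrow> nat list set" where
  "target u = (if u = [] then {[]} else child_set (last u))"

lemma finite_target: "finite (target u)"
  by (simp add: target_def finite_child_set)

text \<open>\<open>B\<close> stands for the colorings of the path up to and including
  \<open>u\<close> for which all its descendants fail; \<open>cover\<close> receives the colors that
  \<open>u\<close> has to fear.\<close>

definition answer :: "nat list \<Rightarrow> nat list set \<Rightarrow> nat list \<Rightarrow> nat" where
  "answer u B = cover (target u) {y. y < q \<and> (\<forall>xs\<in>target u. xs @ [y] \<in> B)}"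

text \<open>\<open>bad c n u\<close> is the set of colorings of the path from the root to \<open>u\<close>, listed from the root, for
  which all proper descendants of \<open>u\<close> guess wrong; \<open>n\<close> is the height \<open>d - length u\<close> of \<open>u\<close>.\<close>

primrec bad :: "(nat list \<Rightarrow> nat) \<Rightarrow> nat \<Rightarrow> nat list \<Rightarrow> nat list set" where
  "bad c 0 u = UNIV"
| "bad c (Suc n) u = {xs. \<forall>i<N. xs @ [c (u @ [i])] \<in> bad c n (u @ [i]) \<and>
     answer (u @ [i]) (bad c n (u @ [i])) xs \<noteq> c (u @ [i])}"

definition guess :: "nat list \<Rightarrow> (nat list \<Rightarrow> nat) \<Rightarrow> nat" where
  "guess u c = answer u (bad c (d - length u) u) (map (\<lambda>i. c (take i u)) [0..<length u])"

lemma answer_less: "answer u B xs < q"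
  unfolding answer_def by (rule cover_less[OF finite_target]) auto

text \<open>Makes \<open>guess\<close> legal: \<open>bad\<close> reads only proper descendants, all
  visible to \<open>u\<close>.\<close>

lemma bad_cong:
  assumes "u \<in> tree_verts d N" "length u + n = d"
    and "\<And>w. w \<in> tree_verts d N \<Longrightarrow> strict_prefix u w \<Longrightarrow> c w = c' w"
  shows "bad c n u = bad c' n u"
  using assms
proof (induction n arbitrary: u)
  case (Suc n)
  have child: "u @ [i] \<in> tree_verts d N" if "i < N" for i
    using that Suc.prems by (auto simp: tree_verts_def)
  have "c (u @ [i]) = c' (u @ [i])" if "i < N" for i
    using child[OF that] by (intro Suc.prems(3)) (auto simp: strict_prefix_def)
  moreover have "bad c n (u @ [i]) = bad c' n (u @ [i])" if "i < N" for i
  proof (rule Suc.IH[OF child[OF that]])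
    show "length (u @ [i]) + n = d" using Suc.prems(2) by simp
    show "c w = c' w" if "w \<in> tree_verts d N" "strict_prefix (u @ [i]) w" for w
      using that by (intro Suc.prems(3)) (auto simp: strict_prefix_def prefix_def)
  qed
  ultimately show ?case by auto
qed simp

lemma guess_restrict:
  assumes u: "u \<in> tree_verts d N"
  shows "guess u (restrict c (nbrs (tree_verts d N) (G_edges d N) u)) = guess u c"
proof -
  let ?c = "restrict c (nbrs (tree_verts d N) (G_edges d N) u)"
  have nb: "?c w = c w" if "w \<in> tree_verts d N" "strict_prefix u w \<or> strict_prefix w u" for w
    using that by (auto simp: nbrs_G[OF u])
  have "bad ?c (d - length u) u = bad c (d - length u) u"
    using u by (intro bad_cong nb) (auto simp: tree_verts_def)
  moreover have "?c (take i u) = c (take i u)" if "i < length u" for i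
  proof (rule nb)
    show "take i u \<in> tree_verts d N" by (rule tree_verts_prefix[OF take_is_prefix u])
    have "take i u \<noteq> u" using that by (metis length_take min.absorb2 nat_less_le min.commute)
    then show "strict_prefix u (take i u) \<or> strict_prefix (take i u) u"
      by (simp add: strict_prefix_def take_is_prefix)
  qed
  then have "map (\<lambda>i. ?c (take i u)) [0..<length u] = map (\<lambda>i. c (take i u)) [0..<length u]"
    by simp
  ultimately show ?thesis unfolding guess_def by (simp only:)
qed

text \<open>Induction on the height \<open>n\<close>: too many feared colors at \<open>u\<close>
  would contradict the claim for one of its children.\<close>

lemma target_not_failing:
  assumes c: "c \<in> tree_verts d N \<rightarrow> {..<q}"
    and u: "u \<in> tree_verts d N" "length u + n = d"
    and T: "target u \<subseteq> {xs. length xs = length u \<and> set xs \<subseteq> {..<q}}"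
      "card (target u) = sylvester (length u) - 1"
  shows "\<exists>xs\<in>target u. xs @ [c u] \<notin> bad c n u \<or> answer u (bad c n u) xs = c u"
  using u T
proof (induction n arbitrary: u)
  case (0 u)
  let ?Y = "{y. y < q \<and> (\<forall>xs\<in>target u. xs @ [y] \<in> bad c 0 u)}"
  \<comment> \<open>A leaf may have to fear all q = s_d - 1 colors, exactly the size of its
    target.\<close>
  have "card ?Y \<le> card {..<q}" by (intro card_mono) auto
  also have "\<dots> = card (target u)" using 0(2,4) q by simp
  finally have "card ?Y \<le> card (target u)" .
  then have "?Y \<subseteq> answer u (bad c 0 u) ` target u"
    unfolding answer_def by (intro cover[OF finite_target]) auto
  moreover have "c u \<in> ?Y" using c 0(1) by auto
  ultimately have "c u \<in> answer u (bad c 0 u) ` target u" by blast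
  then show ?case by (metis imageE)
next
  case (Suc n)
  define T where "T = target u"
  define Y where "Y = {y. y < q \<and> (\<forall>xs\<in>T. xs @ [y] \<in> bad c (Suc n) u)}"
  have "card Y \<le> card T"
  proof (rule ccontr)
    assume "\<not> card Y \<le> card T"
    then have "sylvester (length u) \<le> card Y" using Suc.prems(4) unfolding T_def by linarith
    then have "card T * sylvester (length u) \<le> card T * card Y" by (rule mult_le_mono2)
    then have "sylvester (length u + 1) - 1 \<le> card T * card Y"
      using Suc.prems(4) sylvester_Suc_minus_1[of "length u"]
      by (simp add: T_def del: sylvester.simps)
    also have "\<dots> = card ((\<lambda>(xs, y). xs @ [y]) ` (T \<times> Y))"
      by (subst card_image) (auto simp: inj_on_def card_cartesian_product)
    \<comment> \<open>Shrinking to the exact size makes \<open>S\<close> the target of a child to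
      which the induction hypothesis applies.\<close>
    finally obtain S where S: "S \<subseteq> (\<lambda>(xs, y). xs @ [y]) ` (T \<times> Y)"
      "card S = sylvester (length u + 1) - 1"
      by (rule obtain_subset_with_card_n)
    have S': "S \<subseteq> {xs. length xs = Suc (length u) \<and> set xs \<subseteq> {..<q}}"
      using S(1) Suc.prems(3) by (force simp: T_def Y_def)
    obtain i where i: "i < N" "child_set i = S" using child_set[OF _ S'] Suc.prems(2) by auto
    have target: "target (u @ [i]) = S" using i by (simp add: target_def)
    have "\<exists>xs\<in>target (u @ [i]). xs @ [c (u @ [i])] \<notin> bad c n (u @ [i]) \<or>
        answer (u @ [i]) (bad c n (u @ [i])) xs = c (u @ [i])"
      by (rule Suc.IH) (use Suc.prems(1,2) i(1) S' S(2) target in \<open>auto simp: tree_verts_def simp del: sylvester.simps\<close>)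
    then have "\<not> S \<subseteq> bad c (Suc n) u" using i(1) by (auto simp: target)
    then show False using S(1) by (auto simp: Y_def)
  qed
  then have "Y \<subseteq> answer u (bad c (Suc n) u) ` T"
    unfolding answer_def T_def[symmetric] Y_def[symmetric]
    by (intro cover) (auto simp: T_def finite_target Y_def)
  moreover have "c u < q" using c Suc.prems(1) by auto
  ultimately have "(\<exists>xs\<in>T. xs @ [c u] \<notin> bad c (Suc n) u) \<or> c u \<in> answer u (bad c (Suc n) u) ` T"
    unfolding Y_def by blast
  then show ?case unfolding T_def by (metis imageE)
qed

text \<open>Links the hypothetical colorings in \<open>bad\<close> to the actual \<open>c\<close>;
  the bound \<open>Suc (length u)\<close> includes \<open>u\<close> itself.\<close>

lemma path_in_bad:
  assumes "u \<in> tree_verts d N" "length u + n = d"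
    and "\<And>w. w \<in> tree_verts d N \<Longrightarrow> guess w c \<noteq> c w"
  shows "map (\<lambda>i. c (take i u)) [0..<Suc (length u)] \<in> bad c n u"
  using assms
proof (induction n arbitrary: u)
  case (Suc n)
  have "map (\<lambda>i. c (take i u)) [0..<Suc (length u)] @ [c (u @ [i])] \<in> bad c n (u @ [i]) \<and>
     answer (u @ [i]) (bad c n (u @ [i])) (map (\<lambda>i. c (take i u)) [0..<Suc (length u)]) \<noteq> c (u @ [i])"
    if "i < N" for i
  proof -
    let ?v = "u @ [i]"
    have v: "?v \<in> tree_verts d N" "length ?v + n = d"
      using that Suc.prems by (auto simp: tree_verts_def)
    have path: "map (\<lambda>j. c (take j ?v)) [0..<length ?v] = map (\<lambda>j. c (take j u)) [0..<Suc (length u)]"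
      by (auto simp del: upt_Suc)
    have bad: "map (\<lambda>j. c (take j ?v)) [0..<Suc (length ?v)] \<in> bad c n ?v"
      using v Suc.prems(3) by (rule Suc.IH)
    have "d - length ?v = n" using v(2) by simp
    then have "answer ?v (bad c n ?v) (map (\<lambda>i. c (take i u)) [0..<Suc (length u)]) \<noteq> c ?v"
      using Suc.prems(3)[OF v(1)] unfolding guess_def path by simp
    moreover have "map (\<lambda>j. c (take j ?v)) [0..<Suc (length ?v)] =
        map (\<lambda>i. c (take i u)) [0..<Suc (length u)] @ [c ?v]"
      using path by (simp del: upt_Suc add: upt_Suc_append)
    ultimately show ?thesis using bad by (simp del: upt_Suc)
  qed
  then show ?case unfolding bad.simps mem_Collect_eq by blast
qed simp

lemma guess_in_strategies: "guess \<in> strategies (tree_verts d N) (G_edges d N) q"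
  by (auto simp: strategies_def guess_def answer_less)

lemma winning_guess: "winning (tree_verts d N) (G_edges d N) q guess"
proof -
  have root: "[] \<in> tree_verts d N" by (simp add: tree_verts_def)
  have "\<exists>v\<in>tree_verts d N. guess v c = c v" if c: "c \<in> tree_verts d N \<rightarrow>\<^sub>E {..<q}" for c
  proof (rule ccontr)
    assume "\<not> ?thesis"
    then have wrong: "\<And>v. v \<in> tree_verts d N \<Longrightarrow> guess v c \<noteq> c v" by blast
    \<comment> \<open>The next three facts clash, since \<open>target []\<close> contains only the
      empty list.\<close>
    have "[c []] \<in> bad c d []" using path_in_bad[OF root _ wrong, of d] by simp
    moreover have "answer [] (bad c d []) [] \<noteq> c []" using wrong[OF root] by (simp add: guess_def)
    moreover have "\<exists>xs\<in>target []. xs @ [c []] \<notin> bad c d [] \<or> answer [] (bad c d []) xs = c []"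
      using c root by (intro target_not_failing) (auto simp: target_def)
    ultimately show False by (simp add: target_def)
  qed
  then show ?thesis by (simp add: winning_def guess_restrict)
qed

end

lemma ex_winning_strategy:
  "\<exists>N0. \<forall>N\<ge>N0. \<exists>g \<in> strategies (tree_verts d N) (G_edges d N) (sylvester d - 1).
     winning (tree_verts d N) (G_edges d N) (sylvester d - 1) g"
proof -
  define q where "q = sylvester d - 1"
  have q0: "0 < q" using sylvester_gt_1[of d] by (simp add: q_def)
  define L where "L = {xs :: nat list. set xs \<subseteq> {..<q} \<and> length xs \<le> d}"
  have L: "finite L" unfolding L_def by (rule finite_lists_length_le) simp
  \<comment> \<open>\<open>n\<close> becomes the threshold: that many children can carry all subsets
    of \<open>L\<close>, and surplus ones get the empty set.\<close>
  obtain n f where f: "Pow L = f ` {i::nat. i < n}"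
    using finite_imp_nat_seg_image_inj_on[of "Pow L"] L by auto
  define child_set where "child_set i = (if i < n then f i else {})" for i
  have child_sub: "child_set i \<subseteq> L" for i using f by (auto simp: child_set_def)
  have "\<forall>T Y. \<exists>h. finite (T :: nat list set) \<and> Y \<subseteq> {..<q} \<longrightarrow>
      (\<forall>x. h x < q) \<and> (card Y \<le> card T \<longrightarrow> Y \<subseteq> h ` T)"
  proof (intro allI)
    fix T :: "nat list set" and Y
    show "\<exists>h. finite T \<and> Y \<subseteq> {..<q} \<longrightarrow> (\<forall>x. h x < q) \<and> (card Y \<le> card T \<longrightarrow> Y \<subseteq> h ` T)"
      using ex_cover_map[OF _ q0, of Y T] by meson
  qed
  then obtain cover where cover: "\<And>T Y. finite T \<Longrightarrow> Y \<subseteq> {..<q} \<Longrightarrow>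
      (\<forall>x. cover T Y x < q) \<and> (card Y \<le> card T \<longrightarrow> Y \<subseteq> cover T Y ` (T :: nat list set))"
    by metis
  have "hat_strategy d N q child_set cover" if N: "n \<le> N" for N
  proof
    show "q = sylvester d - 1" by (fact q_def)
    show "\<exists>i<N. child_set i = T"
      if "k \<le> d" "T \<subseteq> {xs. length xs = k \<and> set xs \<subseteq> {..<q}}" for k T
    proof -
      have "T \<in> Pow L" using that by (auto simp: L_def)
      then obtain i where "i < n" "T = f i" using f by auto
      then show ?thesis using N by (intro exI[of _ i]) (auto simp: child_set_def)
    qed
    show "finite (child_set i)" for i using child_sub L finite_subset by blast
  qed (use cover in auto)
  then show ?thesis
    unfolding q_def[symmetric]
    using hat_strategy.guess_in_strategies hat_strategy.winning_guess by blast
qed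

theorem theorem1:
  fixes d :: nat
  assumes "d \<ge> 1"
  shows "\<exists>N0. \<forall>N\<ge>N0. HG (tree_verts d N) (G_edges d N) = sylvester d - 1"
proof -
  obtain N0 where N0: "\<And>N. N \<ge> N0 \<Longrightarrow>
      \<exists>g \<in> strategies (tree_verts d N) (G_edges d N) (sylvester d - 1).
        winning (tree_verts d N) (G_edges d N) (sylvester d - 1) g"
    using ex_winning_strategy[of d] by blast
  have "HG (tree_verts d N) (G_edges d N) = sylvester d - 1" if "N \<ge> N0" for N
    unfolding HG_def
  proof (rule Greatest_equality)
    fix q assume "\<exists>g\<in>strategies (tree_verts d N) (G_edges d N) q.
      winning (tree_verts d N) (G_edges d N) q g"
    then have "\<not> sylvester d \<le> q" using strategy_loses by blast
    then show "q \<le> sylvester d - 1" by linarith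
  qed (rule N0[OF that])
  then show ?thesis by blast
qed

end
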